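(* Let $\mathcal{R}$ be an associative ring with unit $1\neq 0$, let $a\in\mathcal{R}$, let $\mathcal{S},\mathcal{T}$ be right ideals of $\mathcal{R}$ and let $\mathcal{S}',\mathcal{T}'$ be left ideals of $\mathcal{R}$. The following assertions hold. (1) Suppose that any one of the following holds: (a) there is $x\in\mathcal{R}$ with $xax=x$, $x\mathcal{R}=\mathcal{S}$, ${\rm rann}(x)=\mathcal{T}$; (b) there exists $x\in\mathcal{S}$ such that $\varphi_{ax}=\rho_{a\mathcal{S},\mathcal{T}}$, and ${\rm rann}(a)\cap\mathcal{S}=\{0\}$; (c) $\mathcal{R}=a\mathcal{S}\oplus\mathcal{T}$ and ${\rm rann}(a)\cap\mathcal{S}=\{0\}$; (d) there exists $x\in\mathcal{S}$ such that $xas=s$ for all $s\in\mathcal{S}$, $1-ax\in\mathcal{T}$, and $xt=0$ for all $t\in\mathcal{T}$; (e) there is $x\in\mathcal{R}$ with $axa=a$, $xax=x$, $x\mathcal{R}=\mathcal{S}$, ${\rm rann}(x)=\mathcal{T}$; (f) $\mathcal{R}=a\mathcal{R}\oplus\mathcal{T}$ and $\mathcal{R}=\mathcal{S}\oplus{\rm rann}(a)$; (g) condition (c) holds and $a\mathcal{R}\cap\mathcal{T}=\{0\}$; (h) condition (b) holds and $a\mathcal{R}\cap\mathcal{T}=\{0\}$. Then there exist idempotents $p,q\in\mathcal{R}$ such that $\mathcal{S}=p\mathcal{R}$ and $\mathcal{T}={\rm rann}(q)$. (2) Suppose that any one of the following holds: (a) there is $x\in\mathcal{R}$ with $xax=x$,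 $\mathcal{R}x=\mathcal{S}'$, ${\rm lann}(x)=\mathcal{T}'$; (b) there exists $x\in\mathcal{S}'$ such that ${}_{xa}\varphi=\rho_{\mathcal{S}'a,\mathcal{T}'}$, and ${\rm lann}(a)\cap\mathcal{S}'=\{0\}$; (c) $\mathcal{R}=\mathcal{S}'a\oplus\mathcal{T}'$ and ${\rm lann}(a)\cap\mathcal{S}'=\{0\}$; (d) there exists $x\in\mathcal{S}'$ such that $sax=s$ for all $s\in\mathcal{S}'$, $1-xa\in\mathcal{T}'$, and $tx=0$ for all $t\in\mathcal{T}'$; (e) there is $x\in\mathcal{R}$ with $axa=a$, $xax=x$, $\mathcal{R}x=\mathcal{S}'$, ${\rm lann}(x)=\mathcal{T}'$; (f) $\mathcal{R}=\mathcal{R}a\oplus\mathcal{T}'$ and $\mathcal{R}=\mathcal{S}'\oplus{\rm lann}(a)$; (g) condition (c) holds and $\mathcal{R}a\cap\mathcal{T}'=\{0\}$; (h) condition (b) holds and $\mathcal{R}a\cap\mathcal{T}'=\{0\}$. Then there exist idempotents $p,q\in\mathcal{R}$ such that $\mathcal{S}'=\mathcal{R}p$ and $\mathcal{T}'={\rm lann}(q)$. (3) Suppose that any one of the following holds: (a) there is $x\in\mathcal{R}$ with $xax=x$, $x\mathcal{R}=\mathcal{S}$, $\mathcal{R}x=\mathcal{S}'$; (b) $\mathcal{R}=a\mathcal{S}\oplus{\rm rann}(\mathcal{S}')$ and $\mathcal{R}=\mathcal{S}'a\oplus{\rm lann}(\mathcal{S})$; (c) there exists $x\in\mathcal{S}\cap\mathcal{S}'$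 such that $xas=s$ for all $s\in\mathcal{S}$ and $sax=s$ for all $s\in\mathcal{S}'$; (d) there exists $x\in\mathcal{S}\cap\mathcal{S}'$ such that $\varphi_{ax}=\rho_{a\mathcal{S},\,{\rm rann}(\mathcal{S}')}$ and ${}_{xa}\varphi=\rho_{\mathcal{S}'a,\,{\rm lann}(\mathcal{S})}$; (e) there is $x\in\mathcal{R}$ with $axa=a$, $xax=x$, $x\mathcal{R}=\mathcal{S}$, $\mathcal{R}x=\mathcal{S}'$; (f) $\mathcal{R}=a\mathcal{R}\oplus{\rm rann}(\mathcal{S}')$, $\mathcal{R}=\mathcal{S}\oplus{\rm rann}(a)$, $\mathcal{R}=\mathcal{R}a\oplus{\rm lann}(\mathcal{S})$, and $\mathcal{R}=\mathcal{S}'\oplus{\rm lann}(a)$; (g) condition (b) holds, $a\mathcal{R}\cap{\rm rann}(\mathcal{S}')=\{0\}$ and $\mathcal{R}a\cap{\rm lann}(\mathcal{S})=\{0\}$; (h) condition (d) holds, $a\mathcal{R}\cap{\rm rann}(\mathcal{S}')=\{0\}$ and $\mathcal{R}a\cap{\rm lann}(\mathcal{S})=\{0\}$. Then there exist idempotents $p,q\in\mathcal{R}$ such that $\mathcal{S}=p\mathcal{R}$ and $\mathcal{S}'=\mathcal{R}q$. (4) Suppose that there is $x\in\mathcal{R}$ satisfying any one of the following: (a) $xax=x$, ${\rm rann}(x)=\mathcal{T}$, and ${\rm lann}(x)=\mathcal{T}'$; (b) $\varphi_{ax}=\rho_{ax\mathcal{R},\mathcal{T}}$, ${}_{xa}\varphi=\rho_{\mathcal{R}xa,\mathcal{T}'}$,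 and at least one of ${\rm rann}(a)\cap x\mathcal{R}=\{0\}$, ${\rm lann}(a)\cap\mathcal{R}x=\{0\}$, $\mathcal{T}\subseteq{\rm rann}(x)$, $\mathcal{T}'\subseteq{\rm lann}(x)$ holds; (c) $1-ax\in\mathcal{T}$, $xt=0$ for all $t\in\mathcal{T}$, $1-xa\in\mathcal{T}'$, and $tx=0$ for all $t\in\mathcal{T}'$. Then there exist idempotents $p,q\in\mathcal{R}$ such that $\mathcal{T}={\rm rann}(p)$ and $\mathcal{T}'={\rm lann}(q)$.
   Context: An element $p\in\mathcal{R}$ is idempotent if $p^2=p$. Notation: $a\mathcal{R}=\{ar:r\in\mathcal{R}\}$, $\mathcal{R}a=\{ra:r\in\mathcal{R}\}$, $a\mathcal{S}=\{as:s\in\mathcal{S}\}$, $\mathcal{S}'a=\{sa:s\in\mathcal{S}'\}$; ${\rm rann}(a)=\{r:ar=0\}$, ${\rm lann}(a)=\{r:ra=0\}$, and for $\mathcal{A}\subseteq\mathcal{R}$, ${\rm rann}(\mathcal{A})=\{r\in\mathcal{R}:ar=0\ \forall a\in\mathcal{A}\}$, ${\rm lann}(\mathcal{A})=\{r\in\mathcal{R}:ra=0\ \forall a\in\mathcal{A}\}$. The additive group endomorphisms $\varphi_a,{}_a\varphi$ of $\mathcal{R}$ are $\varphi_a(r)=ar$, ${}_a\varphi(r)=ra$. For additive subgroups $\mathcal{S},\mathcal{T}$ of $\mathcal{R}$, $\mathcal{R}=\mathcal{S}\oplus\mathcal{T}$ means $\mathcal{R}=\mathcal{S}+\mathcal{T}$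 and $\mathcal{S}\cap\mathcal{T}=\{0\}$; in that case $\rho_{\mathcal{S},\mathcal{T}}:\mathcal{R}\to\mathcal{R}$ is the group endomorphism $\rho_{\mathcal{S},\mathcal{T}}(s+t)=s$ for $s\in\mathcal{S}$, $t\in\mathcal{T}$. Convention: whenever $\rho_{\mathcal{S},\mathcal{T}}$ is written, it is implicitly asserted that $\mathcal{R}=\mathcal{S}\oplus\mathcal{T}$. *)

theory Defs
  imports "HOL-Library.Set_Algebras"
begin

text \<open>
  The ring is an arbitrary type of class \<^class>\<open>ring_1\<close> (associative, unital, \<open>1 \<noteq> 0\<close>, not
  necessarily commutative), its carrier being \<^term>\<open>UNIV\<close>. With the elementwise operations of
  \<^theory>\<open>HOL-Library.Set_Algebras\<close>, the sets \<open>aS\<close>, \<open>Sa\<close>, \<open>aR\<close>, \<open>Ra\<close> are written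
  \<open>{a} * S\<close>, \<open>S * {a}\<close>, \<open>{a} * UNIV\<close>, \<open>UNIV * {a}\<close>.
\<close>

definition add_subgroup :: "'a::ab_group_add set \<Rightarrow> bool" where
  "add_subgroup S \<longleftrightarrow> 0 \<in> S \<and> (\<forall>x\<in>S. \<forall>y\<in>S. x + y \<in> S) \<and> (\<forall>x\<in>S. - x \<in> S)"

definition right_ideal :: "'a::ring_1 set \<Rightarrow> bool" where
  "right_ideal S \<longleftrightarrow> add_subgroup S \<and> (\<forall>s\<in>S. \<forall>r. s * r \<in> S)"

definition left_ideal :: "'a::ring_1 set \<Rightarrow> bool" where
  "left_ideal S \<longleftrightarrow> add_subgroup S \<and> (\<forall>s\<in>S. \<forall>r. r * s \<in> S)"

definition idempotent :: "'a::ring_1 \<Rightarrow> bool" where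
  "idempotent p \<longleftrightarrow> p ^ 2 = p"

definition rann :: "'a::ring_1 \<Rightarrow> 'a set" where
  "rann a = {r. a * r = 0}"

definition lann :: "'a::ring_1 \<Rightarrow> 'a set" where
  "lann a = {r. r * a = 0}"

definition rann_set :: "'a::ring_1 set \<Rightarrow> 'a set" where
  "rann_set A = {r. \<forall>a\<in>A. a * r = 0}"

definition lann_set :: "'a::ring_1 set \<Rightarrow> 'a set" where
  "lann_set A = {r. \<forall>a\<in>A. r * a = 0}"

definition left_mult :: "'a::ring_1 \<Rightarrow> 'a \<Rightarrow> 'a" where
  "left_mult a = (\<lambda>r. a * r)"

definition right_mult :: "'a::ring_1 \<Rightarrow> 'a \<Rightarrow> 'a" where
  "right_mult a = (\<lambda>r. r * a)"

definition direct_sum :: "'a::ab_group_add set \<Rightarrow> 'a set \<Rightarrow> bool" where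
  "direct_sum S T \<longleftrightarrow> S + T = UNIV \<and> S \<inter> T = {0}"

text \<open>The projection onto \<open>S\<close> along \<open>T\<close>; meaningful only if \<^term>\<open>direct_sum S T\<close> holds and
  both are additive subgroups.\<close>

definition proj_along :: "'a::ab_group_add set \<Rightarrow> 'a set \<Rightarrow> 'a \<Rightarrow> 'a" where
  "proj_along S T r = (THE s. s \<in> S \<and> (\<exists>t\<in>T. r = s + t))"

lemma proj_along_add:
  assumes S: "add_subgroup S" and T: "add_subgroup T" and D: "direct_sum S T"
    and s: "s \<in> S" and t: "t \<in> T"
  shows "proj_along S T (s + t) = s"
  unfolding proj_along_def
proof (rule the_equality)
  show "s \<in> S \<and> (\<exists>t'\<in>T. s + t = s + t')" using s t by blast
next
  fix s' assume "s' \<in> S \<and> (\<exists>t'\<in>T. s + t = s' + t')"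
  then obtain t' where s': "s' \<in> S" and t': "t' \<in> T" and eq: "s + t = s' + t'" by blast
  have "s' + - s \<in> S" using S s s' unfolding add_subgroup_def by blast
  moreover have "t + - t' \<in> T" using T t t' unfolding add_subgroup_def by blast
  moreover have "s' + - s = t + - t'" using eq by (simp add: algebra_simps)
  ultimately have "s' + - s \<in> S \<inter> T" by (metis IntI)
  then have "s' + - s = 0" using D unfolding direct_sum_def by blast
  then show "s' = s" by simp
qed

text \<open>An equation \<open>f = \<rho>\<^bsub>S,T\<^esub>\<close> carries the implicit assertion that the ring is the direct sum
  of \<open>S\<close> and \<open>T\<close>.\<close>

definition is_proj :: "('a::ab_group_add \<Rightarrow> 'a) \<Rightarrow> 'a set \<Rightarrow> 'a set \<Rightarrow> bool" where
  "is_proj f S T \<longleftrightarrow> direct_sum S T \<and> f = proj_along S T"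

end

theory Submission
  imports Defs
begin

text \<open>
  With one exception, \<open>p\<close> and \<open>q\<close> come from an outer inverse of \<open>a\<close>, that is, an \<open>x\<close> with
  \<open>xax = x\<close>. For such an \<open>x\<close> both \<open>xa\<close> and \<open>ax\<close> are idempotent, and they carry the one-sided
  ideals of \<open>x\<close>: \<open>xR = xaR\<close>, \<open>Rx = Rax\<close>, \<open>rann x = rann (ax)\<close> and \<open>lann x = lann (xa)\<close>. So each of
  the four assertions follows once two of these four ideals are the prescribed ones.

  The outer inverse is read off a decomposition of \<open>1\<close>. If \<open>R = aS \<oplus> T\<close>, write \<open>1 = ax + t\<close> with
  \<open>x \<in> S\<close> and \<open>t \<in> T\<close>; multiplying this equation on the right by an element of \<open>aS\<close> or of \<open>T\<close> and
  using that the sum is direct shows that \<open>ax\<close> acts as the identity on \<open>aS\<close> and as zero on \<open>T\<close>, and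
  \<open>S \<inter> rann a = 0\<close> allows \<open>a\<close> to be cancelled
  (\<open>outer_inverse_of_right_decomposition\<close>). With the annihilators \<open>rann S'\<close> and \<open>lann S\<close> as
  complements, the two decompositions of \<open>1\<close> produce one and the same \<open>x\<close>
  (\<open>outer_inverse_of_two_sided_decomposition\<close>). The hypotheses with \<open>R = S \<oplus> rann a\<close> reduce to
  these because then \<open>aR = aS\<close>. The exception is a pair of multiplications by
  \<open>ax\<close> and \<open>xa\<close> projecting along \<open>T\<close> and \<open>T'\<close>, where \<open>ax\<close> and \<open>xa\<close> serve directly: if left
  multiplication by \<open>e\<close> is the projection onto \<open>eR\<close> along \<open>T\<close>, then \<open>e\<close> is idempotent and
  \<open>T = rann e\<close> (\<open>left_mult_is_proj\<close>). Every one-sided argument has a mirror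
  image, obtained by reversing all products.
\<close>

section \<open>One-sided ideals generated or annihilated by an outer inverse\<close>

lemma singleton_times_eq_image: "{a} * S = (\<lambda>s. a * s) ` S" for a :: "'a::ring_1"
  by (auto simp: set_times_def)

lemma times_singleton_eq_image: "S * {a} = (\<lambda>s. s * a) ` S" for a :: "'a::ring_1"
  by (auto simp: set_times_def)

lemma right_ideal_diff: "right_ideal S \<Longrightarrow> s \<in> S \<Longrightarrow> t \<in> S \<Longrightarrow> s - t \<in> S"
  unfolding right_ideal_def add_subgroup_def by (metis diff_conv_add_uminus)

lemma right_ideal_mult: "right_ideal S \<Longrightarrow> s \<in> S \<Longrightarrow> s * r \<in> S"
  by (simp add: right_ideal_def)

lemma left_ideal_diff: "left_ideal S \<Longrightarrow> s \<in> S \<Longrightarrow> t \<in> S \<Longrightarrow> s - t \<in> S"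
  unfolding left_ideal_def add_subgroup_def by (metis diff_conv_add_uminus)

lemma left_ideal_mult: "left_ideal S \<Longrightarrow> s \<in> S \<Longrightarrow> r * s \<in> S"
  by (simp add: left_ideal_def)

lemma outer_inverse_idempotent:
  assumes "x * a * x = x"
  shows "idempotent (x * a)" and "idempotent (a * x)"
  using assms by (metis idempotent_def power2_eq_square mult.assoc)+

lemma outer_inverse_right_ideal:
  fixes a x :: "'a::ring_1"
  assumes "x * a * x = x"
  shows "{x} * UNIV = {x * a} * UNIV"
proof -
  have "x * r = x * a * (x * r)" for r using assms by (metis mult.assoc)
  moreover have "x * a * r = x * (a * r)" for r by (rule mult.assoc)
  ultimately show ?thesis unfolding singleton_times_eq_image by blast
qed

lemma outer_inverse_left_ideal:
  fixes a x :: "'a::ring_1"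
  assumes "x * a * x = x"
  shows "UNIV * {x} = UNIV * {a * x}"
proof -
  have "r * x = (r * x) * (a * x)" for r using assms by (metis mult.assoc)
  moreover have "r * (a * x) = (r * a) * x" for r by (rule mult.assoc[symmetric])
  ultimately show ?thesis unfolding times_singleton_eq_image by blast
qed

lemma outer_inverse_rann:
  assumes "x * a * x = x"
  shows "rann x = rann (a * x)"
  using assms unfolding rann_def by (metis mult.assoc mult_zero_right)

lemma outer_inverse_lann:
  assumes "x * a * x = x"
  shows "lann x = lann (x * a)"
  using assms unfolding lann_def by (metis mult.assoc mult_zero_left)

section \<open>Outer inverses from decompositions of the ring\<close>

lemma direct_sum_obtain:
  assumes "direct_sum S T"
  obtains s t where "s \<in> S" "t \<in> T" "r = s + t"
  using assms unfolding direct_sum_def by (metis UNIV_I set_plus_elim)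

text \<open>Two conditions on \<open>x\<close> that each make it an outer inverse of \<open>a\<close>: the first, \<open>xa\<close> fixing a right
  ideal \<open>S\<close> containing \<open>x\<close>, pins down the range of \<open>x\<close>; the second pins down its annihilator, because
  \<open>xr = 0\<close> gives \<open>r = (1 - ax)r\<close>.\<close>

lemma outer_inverse_of_right_range:
  fixes a x :: "'a::ring_1"
  assumes S: "right_ideal S" and x: "x \<in> S" and fixed: "\<forall>s\<in>S. x * a * s = s"
  shows "x * a * x = x" and "{x} * UNIV = S"
proof -
  show "x * a * x = x" using fixed x by blast
  show "{x} * UNIV = S"
  proof (unfold singleton_times_eq_image, intro equalityI subsetI)
    show "s \<in> S" if "s \<in> range ((*) x)" for s
      using that right_ideal_mult[OF S x] by blast
    show "s \<in> range ((*) x)" if "s \<in> S" for s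
      using that fixed by (metis mult.assoc rangeI)
  qed
qed

lemma outer_inverse_of_left_range:
  fixes a x :: "'a::ring_1"
  assumes S: "left_ideal S" and x: "x \<in> S" and fixed: "\<forall>s\<in>S. s * a * x = s"
  shows "x * a * x = x" and "UNIV * {x} = S"
proof -
  show "x * a * x = x" using fixed x by blast
  show "UNIV * {x} = S"
  proof (unfold times_singleton_eq_image, intro equalityI subsetI)
    show "s \<in> S" if "s \<in> range (\<lambda>r. r * x)" for s
      using that left_ideal_mult[OF S x] by blast
    show "s \<in> range (\<lambda>r. r * x)" if "s \<in> S" for s
      using that fixed by (metis rangeI)
  qed
qed

lemma outer_inverse_of_right_annihilator:
  fixes a x :: "'a::ring_1"
  assumes T: "right_ideal T" and one: "1 - a * x \<in> T" and kill: "\<forall>t\<in>T. x * t = 0"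
  shows "x * a * x = x" and "rann x = T"
proof -
  have "x * (1 - a * x) = 0" using one kill by blast
  then show "x * a * x = x" by (simp add: right_diff_distrib mult.assoc)
  show "rann x = T"
  proof (intro equalityI subsetI)
    fix r assume "r \<in> rann x"
    then have "(1 - a * x) * r = r" by (simp add: rann_def algebra_simps)
    then show "r \<in> T" using right_ideal_mult[OF T one] by metis
  qed (use kill in \<open>simp add: rann_def\<close>)
qed

lemma outer_inverse_of_left_annihilator:
  fixes a x :: "'a::ring_1"
  assumes T: "left_ideal T" and one: "1 - x * a \<in> T" and kill: "\<forall>t\<in>T. t * x = 0"
  shows "x * a * x = x" and "lann x = T"
proof -
  have "(1 - x * a) * x = 0" using one kill by blast
  then show "x * a * x = x" by (simp add: left_diff_distrib)
  show "lann x = T"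
  proof (intro equalityI subsetI)
    fix r assume "r \<in> lann x"
    then have "r * (1 - x * a) = r"
      by (simp add: lann_def right_diff_distrib flip: mult.assoc)
    then show "r \<in> T" using left_ideal_mult[OF T one] by metis
  qed (use kill in \<open>simp add: lann_def\<close>)
qed

text \<open>The two ring elements \<open>as - axas\<close> and \<open>axt\<close> lie in \<open>aS \<inter> T\<close>: in \<open>aS\<close> by their form, in \<open>T\<close>
  by the equation \<open>1 = ax + u\<close>. Both vanish, and \<open>a\<close> is injective on \<open>S\<close>.\<close>

lemma outer_inverse_of_right_decomposition:
  fixes a :: "'a::ring_1"
  assumes S: "right_ideal S" and T: "right_ideal T"
    and D: "direct_sum ({a} * S) T" and inj: "rann a \<inter> S = {0}"
  shows "\<exists>x. x * a * x = x \<and> {x} * UNIV = S \<and> rann x = T"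
proof -
  obtain x u where x: "x \<in> S" and u: "u \<in> T" and one: "1 = a * x + u"
    using direct_sum_obtain[OF D, of 1] unfolding singleton_times_eq_image by blast
  have cancel: "s = 0" if "s \<in> S" "a * s \<in> T" for s
  proof -
    have "a * s \<in> {a} * S \<inter> T" using that by (simp add: singleton_times_eq_image)
    then have "a * s = 0" using D unfolding direct_sum_def by blast
    then have "s \<in> rann a \<inter> S" using that(1) by (simp add: rann_def)
    then show ?thesis using inj by blast
  qed
  have split: "r = a * (x * r) + u * r" for r
    using arg_cong[OF one, of "\<lambda>e. e * r"] by (simp add: algebra_simps)
  have fixed: "x * a * s = s" if s: "s \<in> S" for s
  proof -
    have "a * (s - x * a * s) = u * (a * s)"
      using split[of "a * s"] by (simp add: algebra_simps)
    moreover have "s - x * a * s \<in> S"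
      using s x S by (metis right_ideal_diff right_ideal_mult mult.assoc)
    ultimately have "s - x * a * s = 0"
      using cancel right_ideal_mult[OF T u] by metis
    then show ?thesis by simp
  qed
  have kill: "x * t = 0" if t: "t \<in> T" for t
  proof -
    have "a * (x * t) = t - u * t" using split[of t] by (simp add: algebra_simps)
    then have "a * (x * t) \<in> T" using right_ideal_diff[OF T t right_ideal_mult[OF T u]] by metis
    then show ?thesis using cancel right_ideal_mult[OF S x] by blast
  qed
  have rest: "1 - a * x \<in> T" using one u by (metis add_diff_cancel_left')
  show ?thesis
    using outer_inverse_of_right_range[OF S x, of a]
      outer_inverse_of_right_annihilator[OF T rest] fixed kill
    by (intro exI[of _ x]) simp
qed

lemma outer_inverse_of_left_decomposition:
  fixes a :: "'a::ring_1"
  assumes S: "left_ideal S" and T: "left_ideal T"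
    and D: "direct_sum (S * {a}) T" and inj: "lann a \<inter> S = {0}"
  shows "\<exists>x. x * a * x = x \<and> UNIV * {x} = S \<and> lann x = T"
proof -
  obtain x u where x: "x \<in> S" and u: "u \<in> T" and one: "1 = x * a + u"
    using direct_sum_obtain[OF D, of 1] unfolding times_singleton_eq_image by blast
  have cancel: "s = 0" if "s \<in> S" "s * a \<in> T" for s
  proof -
    have "s * a \<in> S * {a} \<inter> T" using that by (simp add: times_singleton_eq_image)
    then have "s * a = 0" using D unfolding direct_sum_def by blast
    then have "s \<in> lann a \<inter> S" using that(1) by (simp add: lann_def)
    then show ?thesis using inj by blast
  qed
  have split: "r = r * x * a + r * u" for r
    using arg_cong[OF one, of "\<lambda>e. r * e"] by (simp add: algebra_simps)
  have fixed: "s * a * x = s" if s: "s \<in> S" for s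
  proof -
    have "(s - s * a * x) * a = s * a * u"
      using split[of "s * a"] by (metis add_diff_cancel_left' left_diff_distrib)
    moreover have "s - s * a * x \<in> S"
      using s x S by (metis left_ideal_diff left_ideal_mult)
    ultimately have "s - s * a * x = 0"
      using cancel left_ideal_mult[OF T u] by metis
    then show ?thesis by simp
  qed
  have kill: "t * x = 0" if t: "t \<in> T" for t
  proof -
    have "t * x * a = t - t * u" using split[of t] by (simp add: algebra_simps)
    then have "t * x * a \<in> T" using left_ideal_diff[OF T t left_ideal_mult[OF T u]] by metis
    then show ?thesis using cancel left_ideal_mult[OF S x] by blast
  qed
  have rest: "1 - x * a \<in> T" using one u by (metis add_diff_cancel_left')
  show ?thesis
    using outer_inverse_of_left_range[OF S x, of a]
      outer_inverse_of_left_annihilator[OF T rest] fixed kill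
    by (intro exI[of _ x]) simp
qed

text \<open>Every ring element differs from one of \<open>S\<close> by an element that \<open>a\<close> kills, so multiplying by \<open>a\<close>
  sees only \<open>S\<close>.\<close>

lemma singleton_times_complement_rann:
  fixes a :: "'a::ring_1"
  assumes "direct_sum S (rann a)"
  shows "{a} * UNIV = {a} * S"
proof -
  have "a * r \<in> (*) a ` S" for r
  proof -
    obtain s t where "s \<in> S" "a * t = 0" "r = s + t"
      using direct_sum_obtain[OF assms, of r] by (auto simp: rann_def)
    then show ?thesis by (simp add: algebra_simps)
  qed
  then show ?thesis unfolding singleton_times_eq_image by blast
qed

lemma times_singleton_complement_lann:
  fixes a :: "'a::ring_1"
  assumes "direct_sum S (lann a)"
  shows "UNIV * {a} = S * {a}"
proof -
  have "r * a \<in> (\<lambda>s. s * a) ` S" for r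
  proof -
    obtain s t where "s \<in> S" "t * a = 0" "r = s + t"
      using direct_sum_obtain[OF assms, of r] by (auto simp: lann_def)
    then show ?thesis by (simp add: algebra_simps)
  qed
  then show ?thesis unfolding times_singleton_eq_image by blast
qed

text \<open>Write \<open>1 = as + t\<close> and \<open>1 = s'a + t'\<close> with \<open>t\<close> annihilated by \<open>S'\<close> and \<open>t'\<close> annihilating \<open>S\<close>.
  Then \<open>s\<close> and \<open>s'\<close> both equal \<open>s'as\<close>, and this common element is the outer inverse.\<close>

lemma outer_inverse_of_two_sided_decomposition:
  fixes a :: "'a::ring_1"
  assumes S: "right_ideal S" and S': "left_ideal S'"
    and D: "direct_sum ({a} * S) (rann_set S')" and D': "direct_sum (S' * {a}) (lann_set S)"
  shows "\<exists>x. x * a * x = x \<and> {x} * UNIV = S \<and> UNIV * {x} = S'"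
proof -
  obtain s t where s: "s \<in> S" and t: "t \<in> rann_set S'" and one: "1 = a * s + t"
    using direct_sum_obtain[OF D, of 1] unfolding singleton_times_eq_image by blast
  obtain s' t' where s': "s' \<in> S'" and t': "t' \<in> lann_set S" and one': "1 = s' * a + t'"
    using direct_sum_obtain[OF D', of 1] unfolding times_singleton_eq_image by blast
  have left: "v * a * s = v" if "v \<in> S'" for v
    using arg_cong[OF one, of "\<lambda>e. v * e"] t that
    by (simp add: rann_set_def algebra_simps)
  have right: "s' * a * v = v" if "v \<in> S" for v
    using arg_cong[OF one', of "\<lambda>e. e * v"] t' that
    by (simp add: lann_set_def algebra_simps)
  have "s' = s" using left[OF s'] right[OF s] by simp
  then show ?thesis
    using outer_inverse_of_right_range[OF S s, of a] outer_inverse_of_left_range[OF S' s', of a]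
      left right
    by (intro exI[of _ s]) simp
qed

section \<open>Multiplications that are projections\<close>

lemma is_proj_direct_sum: "is_proj f S T \<Longrightarrow> direct_sum S T"
  by (simp add: is_proj_def)

lemma is_proj_apply:
  assumes "add_subgroup S" "add_subgroup T" "is_proj f S T" "s \<in> S" "t \<in> T"
  shows "f (s + t) = s"
  using assms proj_along_add unfolding is_proj_def by metis

lemma is_proj_kernel:
  assumes S: "add_subgroup S" and T: "add_subgroup T" and P: "is_proj f S T"
  shows "f r = 0 \<longleftrightarrow> r \<in> T"
proof -
  obtain s t where st: "s \<in> S" "t \<in> T" "r = s + t"
    using direct_sum_obtain[OF is_proj_direct_sum[OF P]] by metis
  have zero: "0 \<in> S" using S by (simp add: add_subgroup_def)
  have "f r = s" using is_proj_apply[OF S T P] st by simp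
  moreover have "f r = 0" if "r \<in> T" using is_proj_apply[OF S T P zero that] by simp
  ultimately show ?thesis using st by auto
qed

lemma add_subgroup_singleton_times_UNIV:
  "add_subgroup ({e} * UNIV)" for e :: "'a::ring_1"
  unfolding add_subgroup_def singleton_times_eq_image
  by (auto intro: range_eqI[where x = 0] range_eqI[where x = "_ + _"] range_eqI[where x = "- _"]
      simp: distrib_left)

lemma add_subgroup_UNIV_times_singleton:
  "add_subgroup (UNIV * {e})" for e :: "'a::ring_1"
  unfolding add_subgroup_def times_singleton_eq_image
  by (auto intro: range_eqI[where x = 0] range_eqI[where x = "_ + _"] range_eqI[where x = "- _"]
      simp: distrib_right)

text \<open>A projection fixes its range, and \<open>e = e1\<close> lies in the range \<open>eR\<close>, so \<open>ee = e\<close>; its kernel,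
  here \<open>rann e\<close>, is the complement along which it projects.\<close>

lemma left_mult_is_proj:
  fixes e :: "'a::ring_1"
  assumes T: "right_ideal T" and P: "is_proj (left_mult e) ({e} * UNIV) T"
  shows "idempotent e" and "T = rann e"
proof -
  have T': "add_subgroup T" using T by (simp add: right_ideal_def)
  note sub = add_subgroup_singleton_times_UNIV[of e] T'
  have "e \<in> {e} * UNIV" unfolding singleton_times_eq_image by (rule range_eqI[where x = 1]) simp
  moreover have "0 \<in> T" using T' by (simp add: add_subgroup_def)
  ultimately have "left_mult e (e + 0) = e" by (rule is_proj_apply[OF sub P])
  then show "idempotent e" by (simp add: left_mult_def idempotent_def power2_eq_square)
  show "T = rann e" using is_proj_kernel[OF sub P] by (auto simp: left_mult_def rann_def)
qed

lemma right_mult_is_proj: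
  fixes e :: "'a::ring_1"
  assumes T: "left_ideal T" and P: "is_proj (right_mult e) (UNIV * {e}) T"
  shows "idempotent e" and "T = lann e"
proof -
  have T': "add_subgroup T" using T by (simp add: left_ideal_def)
  note sub = add_subgroup_UNIV_times_singleton[of e] T'
  have "e \<in> UNIV * {e}" unfolding times_singleton_eq_image by (rule range_eqI[where x = 1]) simp
  moreover have "0 \<in> T" using T' by (simp add: add_subgroup_def)
  ultimately have "right_mult e (e + 0) = e" by (rule is_proj_apply[OF sub P])
  then show "idempotent e" by (simp add: right_mult_def idempotent_def power2_eq_square)
  show "T = lann e" using is_proj_kernel[OF sub P] by (auto simp: right_mult_def lann_def)
qed

section \<open>Idempotents for prescribed ranges and annihilators\<close>

theorem corollary6p14:
  fixes a :: "'a::ring_1" and S T S' T' :: "'a set"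
  assumes "right_ideal S" and "right_ideal T" and "left_ideal S'" and "left_ideal T'"
  shows "
      (((\<exists>x. x * a * x = x \<and> {x} * UNIV = S \<and> rann x = T) \<or>
          ((\<exists>x\<in>S. is_proj (left_mult (a * x)) ({a} * S) T) \<and> rann a \<inter> S = {0}) \<or>
          (direct_sum ({a} * S) T \<and> rann a \<inter> S = {0}) \<or>
          (\<exists>x\<in>S. (\<forall>s\<in>S. x * a * s = s) \<and> 1 - a * x \<in> T \<and> (\<forall>t\<in>T. x * t = 0)) \<or>
          (\<exists>x. a * x * a = a \<and> x * a * x = x \<and> {x} * UNIV = S \<and> rann x = T) \<or>
          (direct_sum ({a} * UNIV) T \<and> direct_sum S (rann a)) \<or>
          (direct_sum ({a} * S) T \<and> rann a \<inter> S = {0} \<and> ({a} * UNIV) \<inter> T = {0}) \<or>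
          ((\<exists>x\<in>S. is_proj (left_mult (a * x)) ({a} * S) T) \<and> rann a \<inter> S = {0} \<and> ({a} * UNIV) \<inter> T = {0}))
        \<longrightarrow> (\<exists>p q. idempotent p \<and> idempotent q \<and> S = {p} * UNIV \<and> T = rann q))
      \<and>
      (((\<exists>x. x * a * x = x \<and> UNIV * {x} = S' \<and> lann x = T') \<or>
          ((\<exists>x\<in>S'. is_proj (right_mult (x * a)) (S' * {a}) T') \<and> lann a \<inter> S' = {0}) \<or>
          (direct_sum (S' * {a}) T' \<and> lann a \<inter> S' = {0}) \<or>
          (\<exists>x\<in>S'. (\<forall>s\<in>S'. s * a * x = s) \<and> 1 - x * a \<in> T' \<and> (\<forall>t\<in>T'. t * x = 0)) \<or>
          (\<exists>x. a * x * a = a \<and> x * a * x = x \<and> UNIV * {x} = S' \<and> lann x = T') \<or>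
          (direct_sum (UNIV * {a}) T' \<and> direct_sum S' (lann a)) \<or>
          (direct_sum (S' * {a}) T' \<and> lann a \<inter> S' = {0} \<and> (UNIV * {a}) \<inter> T' = {0}) \<or>
          ((\<exists>x\<in>S'. is_proj (right_mult (x * a)) (S' * {a}) T') \<and> lann a \<inter> S' = {0} \<and> (UNIV * {a}) \<inter> T' = {0}))
        \<longrightarrow> (\<exists>p q. idempotent p \<and> idempotent q \<and> S' = UNIV * {p} \<and> T' = lann q))
      \<and>
      (((\<exists>x. x * a * x = x \<and> {x} * UNIV = S \<and> UNIV * {x} = S') \<or>
          (direct_sum ({a} * S) (rann_set S') \<and> direct_sum (S' * {a}) (lann_set S)) \<or>
          (\<exists>x\<in>S \<inter> S'. (\<forall>s\<in>S. x * a * s = s) \<and> (\<forall>s\<in>S'. s * a * x = s)) \<or>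
          (\<exists>x\<in>S \<inter> S'. is_proj (left_mult (a * x)) ({a} * S) (rann_set S') \<and> is_proj (right_mult (x * a)) (S' * {a}) (lann_set S)) \<or>
          (\<exists>x. a * x * a = a \<and> x * a * x = x \<and> {x} * UNIV = S \<and> UNIV * {x} = S') \<or>
          (direct_sum ({a} * UNIV) (rann_set S') \<and> direct_sum S (rann a) \<and> direct_sum (UNIV * {a}) (lann_set S) \<and> direct_sum S' (lann a)) \<or>
          (direct_sum ({a} * S) (rann_set S') \<and> direct_sum (S' * {a}) (lann_set S) \<and> ({a} * UNIV) \<inter> rann_set S' = {0} \<and> (UNIV * {a}) \<inter> lann_set S = {0}) \<or>
          ((\<exists>x\<in>S \<inter> S'. is_proj (left_mult (a * x)) ({a} * S) (rann_set S') \<and> is_proj (right_mult (x * a)) (S' * {a}) (lann_set S)) \<and> ({a} * UNIV) \<inter> rann_set S' = {0} \<and> (UNIV * {a}) \<inter> lann_set S = {0}))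
        \<longrightarrow> (\<exists>p q. idempotent p \<and> idempotent q \<and> S = {p} * UNIV \<and> S' = UNIV * {q}))
      \<and>
      ((\<exists>x. (x * a * x = x \<and> rann x = T \<and> lann x = T') \<or>
          (is_proj (left_mult (a * x)) ({a * x} * UNIV) T \<and> is_proj (right_mult (x * a)) (UNIV * {x * a}) T' \<and>
            (rann a \<inter> ({x} * UNIV) = {0} \<or> lann a \<inter> (UNIV * {x}) = {0} \<or> T \<subseteq> rann x \<or> T' \<subseteq> lann x)) \<or>
          (1 - a * x \<in> T \<and> (\<forall>t\<in>T. x * t = 0) \<and> 1 - x * a \<in> T' \<and> (\<forall>t\<in>T'. t * x = 0)))
        \<longrightarrow> (\<exists>p q. idempotent p \<and> idempotent q \<and> T = rann p \<and> T' = lann q))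
    "
proof (intro conjI impI, goal_cases)
  case 1
  then consider "\<exists>x. x * a * x = x \<and> {x} * UNIV = S \<and> rann x = T"
    | "direct_sum ({a} * S) T \<and> rann a \<inter> S = {0}"
    | "\<exists>x\<in>S. (\<forall>s\<in>S. x * a * s = s) \<and> 1 - a * x \<in> T \<and> (\<forall>t\<in>T. x * t = 0)"
    | "direct_sum ({a} * UNIV) T \<and> direct_sum S (rann a)"
    by (elim disjE) (blast dest: is_proj_direct_sum)+
  then have "\<exists>x. x * a * x = x \<and> {x} * UNIV = S \<and> rann x = T"
  proof cases
    case 2
    then show ?thesis using outer_inverse_of_right_decomposition assms by blast
  next
    case 3
    then show ?thesis
      using outer_inverse_of_right_range[of S] outer_inverse_of_right_annihilator[of T] assms
      by metis
  next
    case 4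
    then have "direct_sum ({a} * S) T" using singleton_times_complement_rann by metis
    moreover have "rann a \<inter> S = {0}" using 4 by (auto simp: direct_sum_def)
    ultimately show ?thesis using outer_inverse_of_right_decomposition assms by blast
  qed
  then obtain x where "x * a * x = x \<and> {x} * UNIV = S \<and> rann x = T"
    by blast
  then show ?case
    using outer_inverse_idempotent[of x a] outer_inverse_right_ideal[of x a]
      outer_inverse_rann[of x a]
    by metis
next
  case 2
  then consider "\<exists>x. x * a * x = x \<and> UNIV * {x} = S' \<and> lann x = T'"
    | "direct_sum (S' * {a}) T' \<and> lann a \<inter> S' = {0}"
    | "\<exists>x\<in>S'. (\<forall>s\<in>S'. s * a * x = s) \<and> 1 - x * a \<in> T' \<and> (\<forall>t\<in>T'. t * x = 0)"
    | "direct_sum (UNIV * {a}) T' \<and> direct_sum S' (lann a)"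
    by (elim disjE) (blast dest: is_proj_direct_sum)+
  then have "\<exists>x. x * a * x = x \<and> UNIV * {x} = S' \<and> lann x = T'"
  proof cases
    case 2
    then show ?thesis using outer_inverse_of_left_decomposition assms by blast
  next
    case 3
    then show ?thesis
      using outer_inverse_of_left_range[of S'] outer_inverse_of_left_annihilator[of T'] assms
      by metis
  next
    case 4
    then have "direct_sum (S' * {a}) T'" using times_singleton_complement_lann by metis
    moreover have "lann a \<inter> S' = {0}" using 4 by (auto simp: direct_sum_def)
    ultimately show ?thesis using outer_inverse_of_left_decomposition assms by blast
  qed
  then obtain x where "x * a * x = x \<and> UNIV * {x} = S' \<and> lann x = T'"
    by blast
  then show ?case
    using outer_inverse_idempotent[of x a] outer_inverse_left_ideal[of x a]
      outer_inverse_lann[of x a]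
    by metis
next
  case 3
  then consider "\<exists>x. x * a * x = x \<and> {x} * UNIV = S \<and> UNIV * {x} = S'"
    | "direct_sum ({a} * S) (rann_set S') \<and> direct_sum (S' * {a}) (lann_set S)"
    | "\<exists>x\<in>S \<inter> S'. (\<forall>s\<in>S. x * a * s = s) \<and> (\<forall>s\<in>S'. s * a * x = s)"
    | "direct_sum ({a} * UNIV) (rann_set S') \<and> direct_sum S (rann a) \<and>
        direct_sum (UNIV * {a}) (lann_set S) \<and> direct_sum S' (lann a)"
    by (elim disjE) (blast dest: is_proj_direct_sum)+
  then have "\<exists>x. x * a * x = x \<and> {x} * UNIV = S \<and> UNIV * {x} = S'"
  proof cases
    case 2
    then show ?thesis using outer_inverse_of_two_sided_decomposition assms by blast
  next
    case 3
    then show ?thesis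
      using outer_inverse_of_right_range[of S] outer_inverse_of_left_range[of S'] assms
      by (metis IntE)
  next
    case 4
    then have "direct_sum ({a} * S) (rann_set S') \<and> direct_sum (S' * {a}) (lann_set S)"
      using singleton_times_complement_rann times_singleton_complement_lann by metis
    then show ?thesis using outer_inverse_of_two_sided_decomposition assms by blast
  qed
  then obtain x where "x * a * x = x \<and> {x} * UNIV = S \<and> UNIV * {x} = S'"
    by blast
  then show ?case
    using outer_inverse_idempotent[of x a] outer_inverse_right_ideal[of x a]
      outer_inverse_left_ideal[of x a]
    by metis
next
  case 4
  then obtain x where "(x * a * x = x \<and> rann x = T \<and> lann x = T') \<or>
      (is_proj (left_mult (a * x)) ({a * x} * UNIV) T \<and>
        is_proj (right_mult (x * a)) (UNIV * {x * a}) T') \<or>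
      (1 - a * x \<in> T \<and> (\<forall>t\<in>T. x * t = 0) \<and> 1 - x * a \<in> T' \<and> (\<forall>t\<in>T'. t * x = 0))"
    by blast
  then consider "x * a * x = x \<and> rann x = T \<and> lann x = T'"
    | "is_proj (left_mult (a * x)) ({a * x} * UNIV) T \<and>
        is_proj (right_mult (x * a)) (UNIV * {x * a}) T'"
    | "1 - a * x \<in> T \<and> (\<forall>t\<in>T. x * t = 0) \<and> 1 - x * a \<in> T' \<and> (\<forall>t\<in>T'. t * x = 0)"
    by (elim disjE) blast+
  then show ?case
  proof cases
    case 1
    then show ?thesis
      using outer_inverse_idempotent[of x a] outer_inverse_rann[of x a] outer_inverse_lann[of x a]
      by metis
  next
    case 2
    then show ?thesis
      using left_mult_is_proj[of T "a * x"] right_mult_is_proj[of T' "x * a"] assms by blast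
  next
    case 3
    then have "x * a * x = x \<and> rann x = T \<and> lann x = T'"
      using outer_inverse_of_right_annihilator[of T a x] outer_inverse_of_left_annihilator[of T' x a]
        assms by blast
    then show ?thesis
      using outer_inverse_idempotent[of x a] outer_inverse_rann[of x a] outer_inverse_lann[of x a]
      by metis
  qed
qed

end
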